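(* Let $F_2=\langle a,b\mid\varnothing\rangle$ be the free group on two generators, $B_1=\{e_{F_2},a,b,a^{-1},b^{-1}\}$, and let $$X_{+}=\Big\{x\in(\mathbb{Z}/2\mathbb{Z})^{F_2}:\ \sum_{s\in B_1}x(gs)=0\text{ for every }g\in F_2\Big\}$$ with the left shift action of $F_2$. Then $F_2\curvearrowright X_{+}$ has naive UPE of all orders; that is, $\mathrm{IE}_k(X_+,F_2)=X_+^k$ for every integer $k\ge2$.
   Context: The left shift action is $(gx)(h)=x(g^{-1}h)$, and $(\mathbb{Z}/2\mathbb{Z})^{F_2}$ has the product topology. For an action of a group $G$ on a compact metrizable space $X$ and a tuple $\mathbf A=(A_1,\dots,A_k)$ of subsets of $X$, $J\subset G$ is an independence set for $\mathbf A$ if for every nonempty finite $I\subset J$ and every $\phi:I\to\{1,\dots,k\}$ we have $\bigcap_{s\in I}s^{-1}A_{\phi(s)}\neq\varnothing$. The independence density of $\mathbf A$ is the largest $q\ge0$ such that every finite $F\subset G$ has a subset of cardinality at least $q|F|$ which is an independence set for $\mathbf A$. $\mathrm{IE}_k(X,G)$ is the set of $(x_1,\dots,x_k)\in X^k$ such that for every product neighborhood $U_1\times\dots\times U_k$ of it the tuple $(U_1,\dots,U_k)$ has positive independence density. *)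

theory Defs
  imports
    "HOL-Analysis.Analysis"
    "HOL-Library.Z2"
    "HOL-Algebra.Group_Action"
begin

section \<open>Independence and naive UPE\<close>

definition compact_metrizable_action ::
  "('g, 'm) monoid_scheme \<Rightarrow> 'x topology \<Rightarrow> ('g \<Rightarrow> 'x \<Rightarrow> 'x) \<Rightarrow> bool" where
  "compact_metrizable_action G X \<alpha> \<longleftrightarrow>
     compact_space X \<and> metrizable_space X \<and> group_action G (topspace X) \<alpha> \<and>
     (\<forall>g\<in>carrier G. continuous_map X X (\<alpha> g))"

text \<open>A \<open>k\<close>-tuple is a function of which only the values on \<open>{1..k}\<close> matter;
  for a group action, \<open>\<alpha> (inv\<^bsub>G\<^esub> s) ` A\<close> is the set \<open>s\<inverse>A\<close>.\<close>

definition independence_set ::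
  "('g, 'm) monoid_scheme \<Rightarrow> ('g \<Rightarrow> 'x \<Rightarrow> 'x) \<Rightarrow> nat \<Rightarrow> (nat \<Rightarrow> 'x set) \<Rightarrow> 'g set \<Rightarrow> bool" where
  "independence_set G \<alpha> k A J \<longleftrightarrow>
     J \<subseteq> carrier G \<and>
     (\<forall>I \<phi>. finite I \<and> I \<noteq> {} \<and> I \<subseteq> J \<and> \<phi> \<in> I \<rightarrow> {1..k} \<longrightarrow>
        (\<Inter>s\<in>I. \<alpha> (inv\<^bsub>G\<^esub> s) ` A (\<phi> s)) \<noteq> {})"

definition independence_density_bound ::
  "('g, 'm) monoid_scheme \<Rightarrow> ('g \<Rightarrow> 'x \<Rightarrow> 'x) \<Rightarrow> nat \<Rightarrow> (nat \<Rightarrow> 'x set) \<Rightarrow> real \<Rightarrow> bool" where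
  "independence_density_bound G \<alpha> k A q \<longleftrightarrow>
     0 \<le> q \<and>
     (\<forall>F. finite F \<and> F \<subseteq> carrier G \<longrightarrow>
        (\<exists>J\<subseteq>F. independence_set G \<alpha> k A J \<and> q * real (card F) \<le> real (card J)))"

definition independence_density ::
  "('g, 'm) monoid_scheme \<Rightarrow> ('g \<Rightarrow> 'x \<Rightarrow> 'x) \<Rightarrow> nat \<Rightarrow> (nat \<Rightarrow> 'x set) \<Rightarrow> real" where
  "independence_density G \<alpha> k A = (GREATEST q. independence_density_bound G \<alpha> k A q)"

definition IE ::
  "nat \<Rightarrow> ('g, 'm) monoid_scheme \<Rightarrow> 'x topology \<Rightarrow> ('g \<Rightarrow> 'x \<Rightarrow> 'x) \<Rightarrow> (nat \<Rightarrow> 'x) set" where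
  "IE k G X \<alpha> =
     {x \<in> {1..k} \<rightarrow>\<^sub>E topspace X.
        \<forall>U. (\<forall>i\<in>{1..k}. U i \<subseteq> topspace X \<and> (\<exists>V. openin X V \<and> x i \<in> V \<and> V \<subseteq> U i)) \<longrightarrow>
            independence_density G \<alpha> k U > 0}"

definition naive_UPE_all_orders ::
  "('g, 'm) monoid_scheme \<Rightarrow> 'x topology \<Rightarrow> ('g \<Rightarrow> 'x \<Rightarrow> 'x) \<Rightarrow> bool" where
  "naive_UPE_all_orders G X \<alpha> \<longleftrightarrow> (\<forall>k\<ge>2. IE k G X \<alpha> = ({1..k} \<rightarrow>\<^sub>E topspace X))"

text \<open>The greatest bound exists, so \<^const>\<open>independence_density\<close> is never an unspecified value.\<close>

lemma independence_density_greatest: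
  fixes G (structure)
  assumes "group G"
  shows "independence_density_bound G \<alpha> k A (independence_density G \<alpha> k A)"
    and "independence_density_bound G \<alpha> k A q \<Longrightarrow> q \<le> independence_density G \<alpha> k A"
proof -
  interpret group G by fact
  let ?P = "independence_density_bound G \<alpha> k A"
  let ?S = "Collect ?P"
  have empty: "independence_set G \<alpha> k A {}"
    by (auto simp: independence_set_def)
  have zero: "?P 0"
    using empty by (auto simp: independence_density_bound_def)
  have le1: "r \<le> 1" if r: "?P r" for r
  proof -
    obtain J where J: "J \<subseteq> {\<one>}" "r * real (card {\<one>}) \<le> real (card J)"
      using r unfolding independence_density_bound_def
      by (metis empty_subsetI finite.emptyI finite_insert insert_subset one_closed)
    have "card J \<le> card {\<one>}" by (intro card_mono J) auto
    with J show ?thesis by simp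
  qed
  have bdd: "bdd_above ?S" using le1 by (auto intro!: bdd_aboveI)
  have upper: "r \<le> Sup ?S" if "?P r" for r
    using cSup_upper[OF _ bdd] that by simp
  have Sup: "?P (Sup ?S)"
    unfolding independence_density_bound_def[of _ _ _ _ "Sup ?S"]
  proof (intro conjI allI impI)
    show "0 \<le> Sup ?S" by (rule upper[OF zero])
    fix F assume F: "finite F \<and> F \<subseteq> carrier G"
    let ?J = "{J. J \<subseteq> F \<and> independence_set G \<alpha> k A J}"
    have fin: "finite (card ` ?J)" using F by auto
    have ne: "card ` ?J \<noteq> {}" using empty by auto
    obtain J where J: "J \<in> ?J" "card J = Max (card ` ?J)"
      using Max_in[OF fin ne] by auto
    have bound: "r * real (card F) \<le> real (card J)" if r: "?P r" for r
    proof -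
      obtain J' where "J' \<in> ?J" "r * real (card F) \<le> real (card J')"
        using r F unfolding independence_density_bound_def by blast
      moreover have "card J' \<le> card J"
        unfolding J(2) using \<open>J' \<in> ?J\<close> by (intro Max_ge fin) auto
      ultimately show ?thesis by linarith
    qed
    have "Sup ?S * real (card F) \<le> real (card J)"
    proof (cases "card F = 0")
      case False
      have "Sup ?S \<le> real (card J) / real (card F)"
        using zero bound False by (intro cSup_least) (auto simp: field_simps)
      thus ?thesis using False by (simp add: field_simps)
    qed simp
    with J show "\<exists>J\<subseteq>F. independence_set G \<alpha> k A J \<and> Sup ?S * real (card F) \<le> real (card J)"
      by auto
  qed
  have eq: "independence_density G \<alpha> k A = Sup ?S"
    unfolding independence_density_def using Sup upper by (rule Greatest_equality)
  show "?P (independence_density G \<alpha> k A)" using Sup eq by simp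
  show "?P q \<Longrightarrow> q \<le> independence_density G \<alpha> k A" using upper eq by simp
qed


section \<open>Free groups\<close>

text \<open>A letter \<open>(a, True)\<close> stands for the generator \<open>a\<close>, and \<open>(a, False)\<close> for its inverse.\<close>

type_synonym 'a letter = "'a \<times> bool"

fun inv_letter :: "'a letter \<Rightarrow> 'a letter" where
  "inv_letter (a, e) = (a, \<not> e)"

definition reduced_word :: "'a letter list \<Rightarrow> bool" where
  "reduced_word w \<longleftrightarrow> successively (\<lambda>l m. m \<noteq> inv_letter l) w"

fun letter_mult :: "'a letter \<Rightarrow> 'a letter list \<Rightarrow> 'a letter list" where
  "letter_mult l [] = [l]"
| "letter_mult l (m # w) = (if m = inv_letter l then w else l # m # w)"

definition free_group :: "'a letter list monoid" where
  "free_group = \<lparr>carrier = Collect reduced_word, mult = (\<lambda>u v. foldr letter_mult u v), one = []\<rparr>"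

definition free_gen :: "'a \<Rightarrow> 'a letter list" where
  "free_gen a = [(a, True)]"

lemma inv_letter_inv_letter [simp]: "inv_letter (inv_letter l) = l"
  by (cases l) auto

lemma reduced_Nil [simp]: "reduced_word []"
  by (simp add: reduced_word_def)

lemma reduced_Cons: "reduced_word (l # w) \<longleftrightarrow> w = [] \<or> hd w \<noteq> inv_letter l \<and> reduced_word w"
  by (auto simp: reduced_word_def successively_Cons)

lemma reduced_tl: "reduced_word (l # w) \<Longrightarrow> reduced_word w"
  by (auto simp: reduced_Cons)

lemma reduced_letter_mult: "reduced_word w \<Longrightarrow> reduced_word (letter_mult l w)"
  by (cases w) (auto simp: reduced_Cons)

lemma letter_mult_cancel: "reduced_word w \<Longrightarrow> letter_mult l (letter_mult (inv_letter l) w) = w"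
  by (cases w; cases "tl w") (auto simp: reduced_Cons)

lemma reduced_foldr_letter_mult: "reduced_word v \<Longrightarrow> reduced_word (foldr letter_mult u v)"
  by (induction u) (auto intro: reduced_letter_mult)

lemma letter_mult_reduced: "reduced_word (l # w) \<Longrightarrow> letter_mult l w = l # w"
  by (cases w) (auto simp: reduced_Cons)

lemma foldr_letter_mult_Nil: "reduced_word u \<Longrightarrow> foldr letter_mult u [] = u"
proof (induction u)
  case (Cons l u)
  thus ?case using reduced_tl[OF Cons.prems] by (simp add: letter_mult_reduced)
qed simp

lemma foldr_letter_mult_letter_mult:
  assumes "reduced_word v"
  shows "foldr letter_mult (letter_mult l u) v = letter_mult l (foldr letter_mult u v)"
  using letter_mult_cancel[OF reduced_foldr_letter_mult[OF assms]] by (cases u) auto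

lemma foldr_letter_mult_assoc:
  assumes "reduced_word w"
  shows "foldr letter_mult (foldr letter_mult u v) w = foldr letter_mult u (foldr letter_mult v w)"
  by (induction u) (simp_all add: foldr_letter_mult_letter_mult assms)

lemma foldr_letter_mult_inverse:
  assumes "reduced_word v"
  shows "foldr letter_mult (rev (map inv_letter u)) (foldr letter_mult u v) = v"
proof (induction u)
  case (Cons l u)
  have "letter_mult (inv_letter l) (letter_mult l (foldr letter_mult u v)) = foldr letter_mult u v"
    using letter_mult_cancel[OF reduced_foldr_letter_mult[OF assms], of "inv_letter l"] by simp
  thus ?case using Cons by simp
qed simp

lemma group_free_group: "group free_group"
proof (rule groupI)
  fix u :: "'a letter list" assume "u \<in> carrier free_group"
  hence u: "reduced_word u" by (simp add: free_group_def)
  let ?v = "foldr letter_mult (rev (map inv_letter u)) []"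
  have "foldr letter_mult ?v u = foldr letter_mult (rev (map inv_letter u)) (foldr letter_mult [] u)"
    by (rule foldr_letter_mult_assoc[OF u])
  also have "\<dots> = foldr letter_mult (rev (map inv_letter u)) (foldr letter_mult u [])"
    using u by (simp add: foldr_letter_mult_Nil)
  also have "\<dots> = []" by (rule foldr_letter_mult_inverse) simp
  finally show "\<exists>v\<in>carrier free_group. v \<otimes>\<^bsub>free_group\<^esub> u = \<one>\<^bsub>free_group\<^esub>"
    by (intro bexI[of _ ?v]) (auto simp: free_group_def intro: reduced_foldr_letter_mult)
qed (auto simp: free_group_def foldr_letter_mult_assoc intro: reduced_foldr_letter_mult)

interpretation free_group: group free_group
  by (rule group_free_group)

lemma free_gen_closed [simp]: "free_gen a \<in> carrier free_group"
  by (simp add: free_gen_def free_group_def reduced_Cons)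

lemma inv_free_gen: "inv\<^bsub>free_group\<^esub> free_gen a = [(a, False)]"
  by (rule free_group.inv_equality) (auto simp: free_gen_def free_group_def reduced_Cons)

text \<open>The universal property: \<^const>\<open>free_group\<close> is free on the generators \<^const>\<open>free_gen\<close>.\<close>

lemma free_group_extend:
  fixes H (structure)
  assumes "group H" and f: "\<And>a. f a \<in> carrier H"
  shows "\<exists>h\<in>hom free_group H. \<forall>a. h (free_gen a) = f a"
proof -
  interpret H: group H by fact
  define val where "val = (\<lambda>l. if snd l then f (fst l) else inv f (fst l))"
  have val: "val l \<in> carrier H" for l by (simp add: val_def f)
  have val_inv: "val (inv_letter l) = inv (val l)" for l
    by (cases l) (auto simp: val_def f)
  define h where "h = (\<lambda>w. foldr (\<lambda>l x. val l \<otimes> x) w \<one>)"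
  have h_simps: "h [] = \<one>" "h (l # w) = val l \<otimes> h w" for l w by (auto simp: h_def)
  have h: "h w \<in> carrier H" for w by (induction w) (auto simp: h_simps val)
  have h_letter: "h (letter_mult l w) = val l \<otimes> h w" for l w
  proof (cases w)
    case (Cons m v)
    thus ?thesis
      by (auto simp: h_simps val h val_inv H.m_assoc[symmetric])
  qed (simp add: h_simps)
  have "h (foldr letter_mult u v) = h u \<otimes> h v" for u v
    by (induction u) (auto simp: h_simps h_letter h val H.m_assoc)
  hence "h \<in> hom free_group H" by (auto simp: hom_def h free_group_def)
  moreover have "h (free_gen a) = f a" for a by (simp add: h_simps free_gen_def val_def f)
  ultimately show ?thesis by blast
qed

lemma free_group_extend_unique:
  fixes H (structure)
  assumes "group H" "h \<in> hom free_group H" "h' \<in> hom free_group H"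
    and eq: "\<And>a. h (free_gen a) = h' (free_gen a)"
    and "w \<in> carrier free_group"
  shows "h w = h' w"
proof -
  interpret h: group_hom free_group H h
    using assms by (simp add: group_hom_def group_hom_axioms_def group_free_group)
  interpret h': group_hom free_group H h'
    using assms by (simp add: group_hom_def group_hom_axioms_def group_free_group)
  have letter: "h [l] = h' [l] \<and> [l] \<in> carrier free_group" for l
  proof -
    obtain a e where l: "l = (a, e)" by fastforce
    show ?thesis
    proof (cases e)
      case True
      thus ?thesis using eq[of a] free_gen_closed[of a] l by (simp add: free_gen_def)
    next
      case False
      have "h (inv\<^bsub>free_group\<^esub> free_gen a) = h' (inv\<^bsub>free_group\<^esub> free_gen a)"
        by (simp add: eq)
      moreover have "inv\<^bsub>free_group\<^esub> free_gen a \<in> carrier free_group" by simp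
      ultimately show ?thesis using False l by (simp add: inv_free_gen)
    qed
  qed
  have "reduced_word w" using assms by (simp add: free_group_def)
  thus ?thesis
  proof (induction w)
    case Nil
    have "h \<one>\<^bsub>free_group\<^esub> = h' \<one>\<^bsub>free_group\<^esub>" by simp
    thus ?case by (simp add: free_group_def)
  next
    case (Cons l w)
    have w: "w \<in> carrier free_group" using Cons by (auto simp: free_group_def dest: reduced_tl)
    have "l # w = [l] \<otimes>\<^bsub>free_group\<^esub> w"
      using Cons.prems by (simp add: free_group_def letter_mult_reduced)
    moreover have "h w = h' w" using Cons reduced_tl by blast
    ultimately show ?case using letter[of l] w by simp
  qed
qed


section \<open>The shift space\<close>

datatype gen = GenA | GenB

type_synonym f2 = "gen letter list"

abbreviation F2 :: "f2 monoid" where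
  "F2 \<equiv> free_group"

definition B1 :: "f2 set" where
  "B1 = {\<one>\<^bsub>F2\<^esub>, free_gen GenA, free_gen GenB,
         inv\<^bsub>F2\<^esub> free_gen GenA, inv\<^bsub>F2\<^esub> free_gen GenB}"

text \<open>The type \<^typ>\<open>bit\<close> is the field with two elements. As \<^term>\<open>carrier F2\<close> is a
  proper subset of its type, configurations are extensional functions on it.\<close>

definition full_shift :: "(f2 \<Rightarrow> bit) topology" where
  "full_shift = product_topology (\<lambda>_. discrete_topology UNIV) (carrier F2)"

definition X_plus :: "(f2 \<Rightarrow> bit) topology" where
  "X_plus = subtopology full_shift
     {x. \<forall>g\<in>carrier F2. (\<Sum>s\<in>B1. x (g \<otimes>\<^bsub>F2\<^esub> s)) = 0}"

text \<open>The outer restriction to the space is required by \<^const>\<open>group_action\<close>.\<close>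

definition left_shift :: "f2 \<Rightarrow> (f2 \<Rightarrow> bit) \<Rightarrow> (f2 \<Rightarrow> bit)" where
  "left_shift g = (\<lambda>x\<in>topspace X_plus. \<lambda>h\<in>carrier F2. x (inv\<^bsub>F2\<^esub> g \<otimes>\<^bsub>F2\<^esub> h))"

lemma B1_explicit: "B1 = {[], [(GenA, True)], [(GenB, True)], [(GenA, False)], [(GenB, False)]}"
  by (simp add: B1_def inv_free_gen) (simp add: free_gen_def free_group_def)

lemma B1_subset: "B1 \<subseteq> carrier F2"
  by (auto simp: B1_def)

lemma topspace_full_shift: "topspace full_shift = carrier F2 \<rightarrow>\<^sub>E UNIV"
  by (simp add: full_shift_def)

lemma topspace_X_plus:
  "topspace X_plus =
     {x \<in> carrier F2 \<rightarrow>\<^sub>E UNIV. \<forall>g\<in>carrier F2. (\<Sum>s\<in>B1. x (g \<otimes>\<^bsub>F2\<^esub> s)) = 0}"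
  by (auto simp: X_plus_def topspace_full_shift)

lemma X_plus_eq: "X_plus = subtopology full_shift (topspace X_plus)"
  unfolding X_plus_def by (simp add: subtopology_restrict)

lemma left_shift_in_X_plus:
  assumes "g \<in> carrier F2" "x \<in> topspace X_plus"
  shows "left_shift g x \<in> topspace X_plus"
proof -
  have "(\<Sum>s\<in>B1. left_shift g x (k \<otimes>\<^bsub>F2\<^esub> s)) = 0" if k: "k \<in> carrier F2" for k
  proof -
    have "(\<Sum>s\<in>B1. left_shift g x (k \<otimes>\<^bsub>F2\<^esub> s)) =
          (\<Sum>s\<in>B1. x ((inv\<^bsub>F2\<^esub> g \<otimes>\<^bsub>F2\<^esub> k) \<otimes>\<^bsub>F2\<^esub> s))"
      using assms k B1_subset
      by (intro sum.cong) (auto simp: left_shift_def free_group.m_assoc subset_iff)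
    also have "\<dots> = 0" using assms k by (simp add: topspace_X_plus)
    finally show ?thesis .
  qed
  moreover have "left_shift g x \<in> carrier F2 \<rightarrow>\<^sub>E UNIV"
    using assms by (simp add: left_shift_def)
  ultimately show ?thesis by (simp add: topspace_X_plus)
qed

lemma left_shift_mult:
  assumes "g \<in> carrier F2" "k \<in> carrier F2" "x \<in> topspace X_plus"
  shows "left_shift (g \<otimes>\<^bsub>F2\<^esub> k) x = left_shift g (left_shift k x)"
  using left_shift_in_X_plus[OF assms(2,3)] assms
  by (auto simp: left_shift_def free_group.inv_mult_group free_group.m_assoc fun_eq_iff)

lemma left_shift_one:
  assumes "x \<in> topspace X_plus"
  shows "left_shift \<one>\<^bsub>F2\<^esub> x = x"
  using assms by (auto simp: left_shift_def topspace_X_plus fun_eq_iff PiE_def extensional_def)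

lemma left_shift_bij:
  assumes g: "g \<in> carrier F2"
  shows "left_shift g \<in> Bij (topspace X_plus)"
proof -
  have "bij_betw (left_shift g) (topspace X_plus) (topspace X_plus)"
  proof (rule bij_betw_byWitness[where f' = "left_shift (inv\<^bsub>F2\<^esub> g)"])
    show "\<forall>x\<in>topspace X_plus. left_shift (inv\<^bsub>F2\<^esub> g) (left_shift g x) = x"
      using g left_shift_mult[of "inv\<^bsub>F2\<^esub> g" g] by (simp add: left_shift_one)
    show "\<forall>x\<in>topspace X_plus. left_shift g (left_shift (inv\<^bsub>F2\<^esub> g) x) = x"
      using g left_shift_mult[of g "inv\<^bsub>F2\<^esub> g"] by (simp add: left_shift_one)
  qed (use g left_shift_in_X_plus in auto)
  thus ?thesis by (simp add: Bij_def left_shift_def)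
qed

lemma group_action_left_shift: "group_action F2 (topspace X_plus) left_shift"
proof -
  have "left_shift (g \<otimes>\<^bsub>F2\<^esub> k) = compose (topspace X_plus) (left_shift g) (left_shift k)"
    if "g \<in> carrier F2" "k \<in> carrier F2" for g k
    using that left_shift_mult[OF that]
    by (auto simp: compose_def fun_eq_iff) (simp add: left_shift_def)
  hence "left_shift \<in> hom F2 (BijGroup (topspace X_plus))"
    using left_shift_bij by (auto simp: hom_def BijGroup_def)
  thus ?thesis
    by (simp add: group_action_def group_hom_def group_hom_axioms_def group_free_group group_BijGroup)
qed

lemma continuous_map_X_plus_coordinate:
  assumes "g \<in> carrier F2"
  shows "continuous_map X_plus (discrete_topology UNIV) (\<lambda>x. x g)"
  unfolding X_plus_def full_shift_def
  using assms by (intro continuous_map_from_subtopology continuous_map_product_projection)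

lemma continuous_map_left_shift:
  assumes g: "g \<in> carrier F2"
  shows "continuous_map X_plus X_plus (left_shift g)"
proof -
  have "continuous_map X_plus full_shift (left_shift g)"
    unfolding full_shift_def continuous_map_componentwise
  proof (intro conjI ballI)
    show "left_shift g ` topspace X_plus \<subseteq> extensional (carrier F2)"
      by (auto simp: left_shift_def)
    fix h assume h: "h \<in> carrier F2"
    have "continuous_map X_plus (discrete_topology UNIV) (\<lambda>x. x (inv\<^bsub>F2\<^esub> g \<otimes>\<^bsub>F2\<^esub> h))"
      using g h by (intro continuous_map_X_plus_coordinate) simp
    thus "continuous_map X_plus (discrete_topology UNIV) (\<lambda>x. left_shift g x h)"
      by (rule continuous_map_eq) (use h in \<open>simp add: left_shift_def\<close>)
  qed
  moreover have "left_shift g \<in> topspace X_plus \<rightarrow> topspace X_plus"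
    using left_shift_in_X_plus[OF g] by auto
  ultimately show ?thesis
    using continuous_map_into_subtopology X_plus_eq by metis
qed

lemma UNIV_bit: "UNIV = {0, 1 :: bit}"
  using bit.exhaust by auto

lemma compact_space_full_shift: "compact_space full_shift"
  by (auto simp: full_shift_def compact_space_product_topology compact_space_discrete_topology UNIV_bit)

lemma closedin_X_plus: "closedin full_shift (topspace X_plus)"
proof -
  have one: "closedin full_shift {x \<in> topspace full_shift. (\<Sum>s\<in>B1. x (g \<otimes>\<^bsub>F2\<^esub> s)) = 0}"
    if g: "g \<in> carrier F2" for g
  proof -
    have "continuous_map full_shift (discrete_topology UNIV) (\<lambda>x. \<Sum>s\<in>S. x (g \<otimes>\<^bsub>F2\<^esub> s))"
      if "finite S" "S \<subseteq> carrier F2" for S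
      using that
    proof (induction S)
      case (insert s S)
      have s: "continuous_map full_shift (discrete_topology UNIV) (\<lambda>x. x (g \<otimes>\<^bsub>F2\<^esub> s))"
        unfolding full_shift_def using insert g by (intro continuous_map_product_projection) auto
      have "continuous_map full_shift
          (prod_topology (discrete_topology UNIV) (discrete_topology UNIV))
          (\<lambda>x. (x (g \<otimes>\<^bsub>F2\<^esub> s), \<Sum>s\<in>S. x (g \<otimes>\<^bsub>F2\<^esub> s)))"
        using s insert by (intro continuous_map_pairedI) auto
      hence pair: "continuous_map full_shift (discrete_topology UNIV)
          (\<lambda>x. (x (g \<otimes>\<^bsub>F2\<^esub> s), \<Sum>s\<in>S. x (g \<otimes>\<^bsub>F2\<^esub> s)))"
        by (simp flip: prod_topology_discrete_topology)
      have "continuous_map (discrete_topology UNIV :: (bit \<times> bit) topology)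
          (discrete_topology UNIV) (\<lambda>(p, q). p + q)"
        by simp
      from continuous_map_compose[OF pair this] have sum:
        "continuous_map full_shift (discrete_topology UNIV)
          (\<lambda>x. x (g \<otimes>\<^bsub>F2\<^esub> s) + (\<Sum>s\<in>S. x (g \<otimes>\<^bsub>F2\<^esub> s)))"
        by (simp add: o_def)
      show ?case using insert.hyps sum by simp
    qed simp
    from this[of B1] have
      "continuous_map full_shift (discrete_topology UNIV) (\<lambda>x. \<Sum>s\<in>B1. x (g \<otimes>\<^bsub>F2\<^esub> s))"
      using B1_subset by (simp add: B1_def)
    from closedin_continuous_map_preimage[OF this, of "{0}"] show ?thesis by simp
  qed
  have "topspace X_plus =
      (\<Inter>g\<in>carrier F2. {x \<in> topspace full_shift. (\<Sum>s\<in>B1. x (g \<otimes>\<^bsub>F2\<^esub> s)) = 0})"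
    unfolding topspace_X_plus topspace_full_shift using free_group.one_closed by blast
  also have "closedin full_shift \<dots>"
    by (rule closedin_INT) (use free_group.one_closed one in blast)+
  finally show ?thesis .
qed

lemma compact_metrizable_action_X_plus: "compact_metrizable_action F2 X_plus left_shift"
proof -
  have "countable (UNIV :: f2 set)"
  proof -
    have "(UNIV :: gen set) = {GenA, GenB}"
      using gen.exhaust by auto
    hence "finite (UNIV :: gen set)"
      by (metis finite.emptyI finite.insertI)
    hence "finite (UNIV :: gen letter set)"
      by (simp add: finite_prod)
    hence "countable (lists (UNIV :: gen letter set))"
      by (intro countable_lists countable_finite)
    thus ?thesis by (simp only: lists_UNIV)
  qed
  hence "countable (carrier F2)" by (rule countable_subset[rotated]) simp
  hence "metrizable_space full_shift"
    unfolding full_shift_def metrizable_space_product_topology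
    by (auto simp: metrizable_space_discrete_topology intro: countable_subset[rotated])
  hence "metrizable_space X_plus"
    by (subst X_plus_eq) (rule metrizable_space_subtopology)
  moreover have "compact_space X_plus"
    by (subst X_plus_eq) (intro compact_space_subtopology closedin_compact_space
        compact_space_full_shift closedin_X_plus)
  ultimately show ?thesis
    using group_action_left_shift continuous_map_left_shift
    by (simp add: compact_metrizable_action_def)
qed

end

theory Submission
  imports Defs
begin

text \<open>The Cayley graph of \<open>F\<^sub>2\<close> is a 4-regular tree, rooted at the identity. A configuration
  prescribed on a union of balls of radius \<open>n + 1\<close>, on each of which it is a translate of an
  element of \<open>X\<^sub>+\<close>, can be extended from the root outwards: the equation at \<open>g\<close> can be solved for
  any child of \<open>g\<close> outside the balls. If the centres are at pairwise distance greater than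
  \<open>2n + 4\<close>, then such a child exists unless \<open>g\<close> is at distance at most \<open>n\<close> from a centre, where the
  equation already holds. Hence separated sets are independence sets, and every finite set
  contains a separated subset of proportion at least the inverse of the size of a ball.\<close>

section \<open>Word length in free groups\<close>

lemma carrier_free_group [simp]: "w \<in> carrier free_group \<longleftrightarrow> reduced_word w"
  by (simp add: free_group_def)

lemma one_free_group: "\<one>\<^bsub>free_group\<^esub> = []"
  by (simp add: free_group_def)

lemma mult_free_group: "u \<otimes>\<^bsub>free_group\<^esub> v = foldr letter_mult u v"
  by (simp add: free_group_def)

lemma reduced_mult [simp]:
  "reduced_word u \<Longrightarrow> reduced_word v \<Longrightarrow> reduced_word (u \<otimes>\<^bsub>free_group\<^esub> v)"
  by (simp add: mult_free_group reduced_foldr_letter_mult)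

lemma reduced_inv [simp]: "reduced_word u \<Longrightarrow> reduced_word (inv\<^bsub>free_group\<^esub> u)"
  using free_group.inv_closed[of u] by simp

lemma reduced_single [simp]: "reduced_word [l]"
  by (simp add: reduced_Cons)

lemma reduced_snoc:
  "reduced_word (w @ [l]) \<longleftrightarrow> reduced_word w \<and> (w \<noteq> [] \<longrightarrow> l \<noteq> inv_letter (last w))"
  by (auto simp: reduced_word_def successively_append_iff)

lemma mult_letter_snoc:
  assumes "reduced_word (w @ [l])"
  shows "w \<otimes>\<^bsub>free_group\<^esub> [l] = w @ [l]"
  using foldr_letter_mult_Nil[OF assms] by (simp add: mult_free_group)

text \<open>The step from a vertex of the tree to its parent \<open>butlast w\<close>;
  \<open>mult_letter_snoc\<close> is the step to a child.\<close>

lemma mult_letter_cancel: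
  assumes "reduced_word w" "w \<noteq> []"
  shows "w \<otimes>\<^bsub>free_group\<^esub> [inv_letter (last w)] = butlast w"
proof -
  obtain v m where w: "w = v @ [m]"
    using assms by (metis rev_exhaust)
  thus ?thesis
    using assms foldr_letter_mult_Nil[of v] by (simp add: mult_free_group reduced_snoc)
qed

lemma length_mult_le: "length (u \<otimes>\<^bsub>free_group\<^esub> v) \<le> length u + length v"
proof -
  have "length (letter_mult l w) \<le> Suc (length w)" for l :: "'a letter" and w
    by (cases w) auto
  thus ?thesis
    unfolding mult_free_group
    by (induction u) (auto intro: order_trans)
qed

lemma length_inv:
  assumes "reduced_word w"
  shows "length (inv\<^bsub>free_group\<^esub> w) = length w"
proof -
  have le: "length (inv\<^bsub>free_group\<^esub> u) \<le> length u" if u: "reduced_word u" for u :: "'a letter list"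
  proof -
    let ?v = "foldr letter_mult (rev (map inv_letter u)) []"
    have v: "reduced_word ?v" by (rule reduced_foldr_letter_mult) simp
    have "foldr letter_mult ?v u = foldr letter_mult (rev (map inv_letter u)) (foldr letter_mult u [])"
      using foldr_letter_mult_assoc[OF u] foldr_letter_mult_Nil[OF u] by simp
    hence "?v \<otimes>\<^bsub>free_group\<^esub> u = \<one>\<^bsub>free_group\<^esub>"
      using foldr_letter_mult_inverse[of "[]" u] by (simp add: mult_free_group one_free_group)
    hence "inv\<^bsub>free_group\<^esub> u = ?v"
      using u v by (intro free_group.inv_equality) auto
    thus ?thesis
      using length_mult_le[of "rev (map inv_letter u)" "[]"] by (simp add: mult_free_group)
  qed
  from le[OF assms] le[OF reduced_inv[OF assms]] show ?thesis
    using assms by simp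
qed

section \<open>Extending partial configurations\<close>

lemma UNIV_letter:
  "UNIV = {(GenA, True), (GenB, True), (GenA, False), (GenB, False)}"
proof -
  have "p \<in> {(GenA, True), (GenB, True), (GenA, False), (GenB, False)}" for p :: "gen letter"
    by (cases p; cases "fst p"; cases "snd p") auto
  thus ?thesis by blast
qed

lemma finite_letter [simp]: "finite (A :: gen letter set)"
  by (rule finite_subset[OF subset_UNIV]) (simp add: UNIV_letter)

text \<open>Of the four directions, two may be blocked: the one to the parent and the one towards a
  nearby centre.\<close>

lemma exists_letter_avoiding: "\<exists>l :: gen letter. l \<noteq> p \<and> l \<noteq> q"
proof (rule ccontr)
  assume "\<not> ?thesis"
  hence "UNIV \<subseteq> {p, q}" by auto
  hence "card (UNIV :: gen letter set) \<le> card {p, q}" by (intro card_mono) auto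
  also have "\<dots> \<le> 2" by (cases "p = q") auto
  finally show False by (simp add: UNIV_letter)
qed

lemma finite_words: "finite {w :: f2. length w \<le> r}"
  using finite_lists_length_le[of "UNIV :: gen letter set" r] by simp

text \<open>Apart from the identity, \<open>B1\<close> consists of single letters, and right
  multiplication by them leads to the neighbours of \<open>g\<close>: its children and, unless
  \<open>g\<close> is the root, its parent.\<close>

lemma sum_B1:
  fixes x :: "f2 \<Rightarrow> bit"
  assumes g: "reduced_word g"
  shows "(\<Sum>s\<in>B1. x (g \<otimes>\<^bsub>F2\<^esub> s)) =
    x g + (if g = [] then 0 else x (butlast g)) + (\<Sum>l | reduced_word (g @ [l]). x (g @ [l]))"
proof -
  have "B1 = insert [] ((\<lambda>l. [l]) ` UNIV)"
    unfolding B1_explicit UNIV_letter by auto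
  hence "(\<Sum>s\<in>B1. x (g \<otimes>\<^bsub>F2\<^esub> s)) =
      (\<Sum>s\<in>insert [] ((\<lambda>l. [l]) ` UNIV). x (g \<otimes>\<^bsub>F2\<^esub> s))"
    by (simp only:)
  also have "\<dots> = x (g \<otimes>\<^bsub>F2\<^esub> []) + (\<Sum>s\<in>(\<lambda>l. [l]) ` UNIV. x (g \<otimes>\<^bsub>F2\<^esub> s))"
    by (rule sum.insert) auto
  also have "(\<Sum>s\<in>(\<lambda>l. [l]) ` UNIV. x (g \<otimes>\<^bsub>F2\<^esub> s)) = (\<Sum>l\<in>UNIV. x (g \<otimes>\<^bsub>F2\<^esub> [l]))"
    by (subst sum.reindex) (auto simp: inj_on_def)
  also have "g \<otimes>\<^bsub>F2\<^esub> [] = g"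
    using g free_group.r_one[of g] by (simp add: one_free_group)
  also have "(\<Sum>l\<in>UNIV. x (g \<otimes>\<^bsub>F2\<^esub> [l])) =
      (\<Sum>l | \<not> reduced_word (g @ [l]). x (g \<otimes>\<^bsub>F2\<^esub> [l])) +
      (\<Sum>l | reduced_word (g @ [l]). x (g \<otimes>\<^bsub>F2\<^esub> [l]))"
    by (subst sum.union_disjoint[symmetric]) (auto intro!: sum.cong)
  also have "(\<Sum>l | reduced_word (g @ [l]). x (g \<otimes>\<^bsub>F2\<^esub> [l])) =
      (\<Sum>l | reduced_word (g @ [l]). x (g @ [l]))"
    by (intro sum.cong) (auto simp: mult_letter_snoc)
  also have "{l. \<not> reduced_word (g @ [l])} = (if g = [] then {} else {inv_letter (last g)})"
    using g by (auto simp: reduced_snoc)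
  finally show ?thesis
    using mult_letter_cancel[OF g] by (simp add: add.assoc del: add_bit_eq_xor)
qed

text \<open>Leads to the child of \<open>g\<close> whose value serves to solve the equation at
  \<open>g\<close>; unspecified if every child lies in \<open>P\<close>.\<close>

definition free_letter :: "f2 set \<Rightarrow> f2 \<Rightarrow> gen letter" where
  "free_letter P g = (SOME l. reduced_word (g @ [l]) \<and> g @ [l] \<notin> P)"

text \<open>The last branch solves the equation at \<open>g = butlast w\<close> for the value at
  \<open>w\<close>: signs do not matter in characteristic 2, and the other children of
  \<open>g\<close> outside \<open>P\<close> get 0. As children in \<open>P\<close> enter through
  \<open>y\<close>, the recursion only descends to shorter words.\<close>

fun tree_extension :: "f2 set \<Rightarrow> (f2 \<Rightarrow> bit) \<Rightarrow> f2 \<Rightarrow> bit" where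
  "tree_extension P y w =
    (if w \<in> P then y w
     else if w = [] \<or> last w \<noteq> free_letter P (butlast w) then 0
     else let g = butlast w in
       tree_extension P y g + (if g = [] then 0 else tree_extension P y (butlast g)) +
       (\<Sum>l | reduced_word (g @ [l]) \<and> g @ [l] \<in> P. y (g @ [l])))"

declare tree_extension.simps [simp del]

text \<open>At a vertex with a child outside \<open>P\<close>, the value at the chosen child makes
  the equation true; at any other vertex the equation involves only prescribed values.\<close>

lemma extend_partial_configuration:
  assumes P: "\<And>g. reduced_word g \<Longrightarrow>
      (\<exists>l. reduced_word (g @ [l]) \<and> g @ [l] \<notin> P) \<or>
      (\<forall>s\<in>B1. g \<otimes>\<^bsub>F2\<^esub> s \<in> P) \<and> (\<Sum>s\<in>B1. y (g \<otimes>\<^bsub>F2\<^esub> s)) = 0"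
  shows "\<exists>z\<in>topspace X_plus. \<forall>h\<in>P. reduced_word h \<longrightarrow> z h = y h"
proof -
  let ?z = "tree_extension P y"
  have zP: "?z h = y h" if "h \<in> P" for h
    using that by (simp add: tree_extension.simps[of P y h])
  have "(\<Sum>s\<in>B1. ?z (g \<otimes>\<^bsub>F2\<^esub> s)) = 0" if g: "reduced_word g" for g
  proof (cases "\<exists>l. reduced_word (g @ [l]) \<and> g @ [l] \<notin> P")
    case True
    let ?m = "free_letter P g"
    let ?C = "{l. reduced_word (g @ [l])}"
    let ?D = "{l. reduced_word (g @ [l]) \<and> g @ [l] \<in> P}"
    have m: "reduced_word (g @ [?m])" "g @ [?m] \<notin> P"
      using someI_ex[OF True] by (auto simp: free_letter_def)
    have "(\<Sum>l\<in>?C. ?z (g @ [l])) = ?z (g @ [?m]) + (\<Sum>l\<in>?C - {?m}. ?z (g @ [l]))"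
      using m by (intro sum.remove) auto
    also have "(\<Sum>l\<in>?C - {?m}. ?z (g @ [l])) = (\<Sum>l\<in>?D. y (g @ [l]))"
      using m by (intro sum.mono_neutral_cong_right)
        (auto simp: zP tree_extension.simps[of P y "g @ [l]" for l])
    also have "?z (g @ [?m]) =
        ?z g + (if g = [] then 0 else ?z (butlast g)) + (\<Sum>l\<in>?D. y (g @ [l]))"
      using m by (subst tree_extension.simps) (simp add: Let_def)
    finally have children: "(\<Sum>l\<in>?C. ?z (g @ [l])) =
        ?z g + (if g = [] then 0 else ?z (butlast g)) + (\<Sum>l\<in>?D. y (g @ [l])) + (\<Sum>l\<in>?D. y (g @ [l]))" .
    \<comment> \<open>\<open>a\<close>, \<open>p\<close> and \<open>d\<close> are the terms of
      \<open>g\<close>, of its parent and of the prescribed children; each occurs twice.\<close>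
    have "a + p + (a + p + d + d) = 0" for a p d :: bit
      by (cases a; cases p; cases d) auto
    thus ?thesis unfolding sum_B1[OF g] children by blast
  next
    case False
    hence "(\<Sum>s\<in>B1. ?z (g \<otimes>\<^bsub>F2\<^esub> s)) = (\<Sum>s\<in>B1. y (g \<otimes>\<^bsub>F2\<^esub> s))"
      using P[OF g] by (intro sum.cong zP) auto
    also have "\<dots> = 0" using P[OF g] False by blast
    finally show ?thesis .
  qed
  moreover have "reduced_word s" if "s \<in> B1" for s
    using that B1_subset by auto
  ultimately have "restrict ?z (carrier F2) \<in> topspace X_plus"
    by (simp add: topspace_X_plus)
  with zP show ?thesis by (intro bexI[of _ "restrict ?z (carrier F2)"]) auto
qed

section \<open>Gluing and independence\<close>

text \<open>The length is the left-invariant word distance between the inverses of \<open>s\<close>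
  and \<open>t\<close>. The inverses serve as centres because the translate of \<open>z\<close> by
  \<open>s\<close> takes at \<open>h\<close> the value of \<open>z\<close> at the inverse of
  \<open>s\<close> times \<open>h\<close>.\<close>

definition separated :: "nat \<Rightarrow> f2 set \<Rightarrow> bool" where
  "separated r J \<longleftrightarrow> (\<forall>s\<in>J. \<forall>t\<in>J. s \<noteq> t \<longrightarrow> r < length (s \<otimes>\<^bsub>F2\<^esub> inv\<^bsub>F2\<^esub> t))"

text \<open>The triangle inequality for the inverses of \<open>s\<close> and \<open>t\<close> and
  the point \<open>g\<close>.\<close>

lemma length_mult_inv_le:
  assumes "reduced_word s" "reduced_word t" "reduced_word g"
  shows "length (s \<otimes>\<^bsub>free_group\<^esub> inv\<^bsub>free_group\<^esub> t) \<le>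
    length (s \<otimes>\<^bsub>free_group\<^esub> g) + length (t \<otimes>\<^bsub>free_group\<^esub> g)"
proof -
  have "(s \<otimes>\<^bsub>free_group\<^esub> g) \<otimes>\<^bsub>free_group\<^esub> inv\<^bsub>free_group\<^esub> (t \<otimes>\<^bsub>free_group\<^esub> g) =
      s \<otimes>\<^bsub>free_group\<^esub> (g \<otimes>\<^bsub>free_group\<^esub> inv\<^bsub>free_group\<^esub> g) \<otimes>\<^bsub>free_group\<^esub> inv\<^bsub>free_group\<^esub> t"
    using assms by (simp add: free_group.inv_mult_group free_group.m_assoc[of s g]
      free_group.m_assoc[of s _ "inv\<^bsub>free_group\<^esub> t"] flip: free_group.m_assoc[of g])
  also have "\<dots> = s \<otimes>\<^bsub>free_group\<^esub> inv\<^bsub>free_group\<^esub> t"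
    using assms by simp
  finally have "length (s \<otimes>\<^bsub>free_group\<^esub> inv\<^bsub>free_group\<^esub> t) \<le>
      length (s \<otimes>\<^bsub>free_group\<^esub> g) + length (inv\<^bsub>free_group\<^esub> (t \<otimes>\<^bsub>free_group\<^esub> g))"
    by (metis length_mult_le)
  thus ?thesis
    using assms by (simp add: length_inv)
qed

text \<open>The equations within distance \<open>n\<close> of a centre involve only its ball of
  radius \<open>n + 1\<close>. A vertex with a child in such a ball is within \<open>n + 2\<close>
  of the centre, and the bound \<open>2 * n + 4\<close> makes the balls of radius
  \<open>n + 2\<close> disjoint.\<close>

lemma glue_on_separated:
  assumes J: "separated (2 * n + 4) J" "J \<subseteq> carrier F2"
    and x: "\<And>s. s \<in> J \<Longrightarrow> x s \<in> topspace X_plus"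
  shows "\<exists>z\<in>topspace X_plus. \<forall>s\<in>J. \<forall>h. reduced_word h \<longrightarrow> length h \<le> n + 1 \<longrightarrow>
    z (inv\<^bsub>F2\<^esub> s \<otimes>\<^bsub>F2\<^esub> h) = x s h"
proof -
  have unique: "s = t"
    if "s \<in> J" "t \<in> J" "reduced_word g"
      "length (s \<otimes>\<^bsub>F2\<^esub> g) \<le> n + 2" "length (t \<otimes>\<^bsub>F2\<^esub> g) \<le> n + 2" for s t g
  proof (rule ccontr)
    assume "s \<noteq> t"
    hence "2 * n + 4 < length (s \<otimes>\<^bsub>F2\<^esub> inv\<^bsub>F2\<^esub> t)"
      using J that by (auto simp: separated_def)
    moreover have "length (s \<otimes>\<^bsub>F2\<^esub> inv\<^bsub>F2\<^esub> t) \<le> length (s \<otimes>\<^bsub>F2\<^esub> g) + length (t \<otimes>\<^bsub>F2\<^esub> g)"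
      using J that by (intro length_mult_inv_le) auto
    ultimately show False using that by linarith
  qed
  define P where "P = {g. reduced_word g \<and> (\<exists>s\<in>J. length (s \<otimes>\<^bsub>F2\<^esub> g) \<le> n + 1)}"
  \<comment> \<open>On the union \<open>P\<close> of the balls, the choice picks the one centre
    whose ball contains \<open>g\<close>.\<close>
  define y where "y = (\<lambda>g. x (SOME s. s \<in> J \<and> length (s \<otimes>\<^bsub>F2\<^esub> g) \<le> n + 1)
    ((SOME s. s \<in> J \<and> length (s \<otimes>\<^bsub>F2\<^esub> g) \<le> n + 1) \<otimes>\<^bsub>F2\<^esub> g))"
  have y: "y g = x s (s \<otimes>\<^bsub>F2\<^esub> g)"
    if "s \<in> J" "reduced_word g" "length (s \<otimes>\<^bsub>F2\<^esub> g) \<le> n + 1" for s g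
  proof -
    have "(SOME s. s \<in> J \<and> length (s \<otimes>\<^bsub>F2\<^esub> g) \<le> n + 1) = s"
      using that unique[of _ s g] by (intro some_equality) force+
    thus ?thesis by (simp add: y_def)
  qed
  have "(\<exists>l. reduced_word (g @ [l]) \<and> g @ [l] \<notin> P) \<or>
      (\<forall>s\<in>B1. g \<otimes>\<^bsub>F2\<^esub> s \<in> P) \<and> (\<Sum>s\<in>B1. y (g \<otimes>\<^bsub>F2\<^esub> s)) = 0"
    if g: "reduced_word g" for g
  proof (cases "\<exists>s\<in>J. length (s \<otimes>\<^bsub>F2\<^esub> g) \<le> n")
    case True
    then obtain s where s: "s \<in> J" "length (s \<otimes>\<^bsub>F2\<^esub> g) \<le> n" by blast
    have rs: "reduced_word s" using s J by auto
    have B: "reduced_word b" "length b \<le> 1" if "b \<in> B1" for b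
      using that by (auto simp: B1_explicit)
    have assoc: "s \<otimes>\<^bsub>F2\<^esub> (g \<otimes>\<^bsub>F2\<^esub> b) = (s \<otimes>\<^bsub>F2\<^esub> g) \<otimes>\<^bsub>F2\<^esub> b" if "b \<in> B1" for b
      using rs g B[OF that] by (simp add: free_group.m_assoc)
    have near: "length (s \<otimes>\<^bsub>F2\<^esub> (g \<otimes>\<^bsub>F2\<^esub> b)) \<le> n + 1" if "b \<in> B1" for b
      unfolding assoc[OF that]
      using length_mult_le[of "s \<otimes>\<^bsub>F2\<^esub> g" b] s B[OF that] by linarith
    have "(\<Sum>b\<in>B1. y (g \<otimes>\<^bsub>F2\<^esub> b)) = (\<Sum>b\<in>B1. x s ((s \<otimes>\<^bsub>F2\<^esub> g) \<otimes>\<^bsub>F2\<^esub> b))"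
      using s g near B by (intro sum.cong) (auto simp: y assoc)
    also have "\<dots> = 0"
      using x[OF s(1)] reduced_mult[OF rs g] by (simp add: topspace_X_plus)
    finally show ?thesis
      using s g near B by (auto simp: P_def)
  next
    case False
    hence far: "n < length (s \<otimes>\<^bsub>F2\<^esub> g)" if "s \<in> J" for s using that by force
    have step: "length (s \<otimes>\<^bsub>F2\<^esub> g) \<le> n + 2"
      if "s \<in> J" "length (s \<otimes>\<^bsub>F2\<^esub> (g @ [l])) \<le> n + 1" "reduced_word (g @ [l])" for s l
    proof -
      have "s \<otimes>\<^bsub>F2\<^esub> g = (s \<otimes>\<^bsub>F2\<^esub> (g @ [l])) \<otimes>\<^bsub>F2\<^esub> [inv_letter l]"
        using that J g mult_letter_cancel[of "g @ [l]"]
        by (subst free_group.m_assoc) auto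
      thus ?thesis
        using length_mult_le[of "s \<otimes>\<^bsub>F2\<^esub> (g @ [l])" "[inv_letter l]"] that by simp
    qed
    \<comment> \<open>At most one centre is within distance \<open>n + 2\<close> of \<open>g\<close>; every letter but \<open>p\<close> leads away from it.\<close>
    obtain p where p: "s \<in> J \<Longrightarrow> length (s \<otimes>\<^bsub>F2\<^esub> g) \<le> n + 2 \<Longrightarrow>
        inv_letter (last (s \<otimes>\<^bsub>F2\<^esub> g)) = p" for s
      using unique[OF _ _ g] by metis
    \<comment> \<open>Avoiding the inverse of the last letter keeps the extended word reduced, so
      that it is a child of \<open>g\<close>; at the root, \<open>last g\<close> is just some fixed
      letter.\<close>
    obtain l where l: "l \<noteq> p" "l \<noteq> inv_letter (last g)"
      using exists_letter_avoiding by blast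
    have rl: "reduced_word (g @ [l])" using g l by (simp add: reduced_snoc)
    have "g @ [l] \<notin> P"
    proof
      assume "g @ [l] \<in> P"
      then obtain s where s: "s \<in> J" "length (s \<otimes>\<^bsub>F2\<^esub> (g @ [l])) \<le> n + 1"
        by (auto simp: P_def)
      have rs: "reduced_word s" using s J by auto
      \<comment> \<open>The centre of \<open>s\<close> is within \<open>n + 2\<close> of
        \<open>g\<close>, so \<open>p\<close> points towards it, and the step by \<open>l\<close>
        raises the distance from more than \<open>n\<close> to more than
        \<open>n + 1\<close>.\<close>
      have "reduced_word ((s \<otimes>\<^bsub>F2\<^esub> g) @ [l])"
        using p[OF s(1) step[OF s rl]] l reduced_mult[OF rs g] by (simp add: reduced_snoc)
      hence "(s \<otimes>\<^bsub>F2\<^esub> g) @ [l] = s \<otimes>\<^bsub>F2\<^esub> (g \<otimes>\<^bsub>F2\<^esub> [l])"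
        using rs g by (simp add: mult_letter_snoc free_group.m_assoc flip: mult_letter_snoc)
      hence "length (s \<otimes>\<^bsub>F2\<^esub> (g @ [l])) = length (s \<otimes>\<^bsub>F2\<^esub> g) + 1"
        using rl by (metis length_append_singleton mult_letter_snoc Suc_eq_plus1)
      thus False using s far[OF s(1)] by linarith
    qed
    with rl show ?thesis by blast
  qed
  from extend_partial_configuration[OF this]
  obtain z where z: "z \<in> topspace X_plus" "\<And>h. h \<in> P \<Longrightarrow> reduced_word h \<Longrightarrow> z h = y h" by blast
  have "z (inv\<^bsub>F2\<^esub> s \<otimes>\<^bsub>F2\<^esub> h) = x s h"
    if s: "s \<in> J" and h: "reduced_word h" "length h \<le> n + 1" for s h
  proof -
    have rs: "reduced_word s" using s J by auto
    have ri: "reduced_word (inv\<^bsub>F2\<^esub> s)" using rs by simp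
    have "s \<otimes>\<^bsub>F2\<^esub> (inv\<^bsub>F2\<^esub> s \<otimes>\<^bsub>F2\<^esub> h) = h"
      using rs ri h by (simp flip: free_group.m_assoc)
    hence near: "length (s \<otimes>\<^bsub>F2\<^esub> (inv\<^bsub>F2\<^esub> s \<otimes>\<^bsub>F2\<^esub> h)) \<le> n + 1"
        and "y (inv\<^bsub>F2\<^esub> s \<otimes>\<^bsub>F2\<^esub> h) = x s h"
      using y[OF s reduced_mult[OF ri h(1)]] h(2) by simp_all
    moreover have "inv\<^bsub>F2\<^esub> s \<otimes>\<^bsub>F2\<^esub> h \<in> P"
      unfolding P_def using near s reduced_mult[OF ri h(1)] by blast
    ultimately show ?thesis
      using z(2) reduced_mult[OF ri h(1)] by simp
  qed
  with z(1) show ?thesis by blast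
qed

section \<open>Packing: separated subsets of positive proportion\<close>

text \<open>If \<open>J\<close> is a maximal separated subset of \<open>F\<close>, every element of
  \<open>F\<close> is a word of length at most \<open>r\<close> times an element of
  \<open>J\<close>.\<close>

lemma large_separated_subset:
  assumes F: "finite F" "F \<subseteq> carrier F2"
  shows "\<exists>J\<subseteq>F. separated r J \<and> card F \<le> card J * card {w :: f2. length w \<le> r}"
proof -
  let ?S = "{J. J \<subseteq> F \<and> separated r J}"
  have "finite ?S" using F by auto
  moreover have "{} \<in> ?S" by (simp add: separated_def)
  ultimately obtain J where J: "J \<in> ?S" and max: "\<And>K. K \<in> ?S \<Longrightarrow> J \<subseteq> K \<Longrightarrow> K = J"
    using finite_has_maximal2[of ?S "{}"] by (metis (no_types, lifting))
  let ?B = "{w :: f2. length w \<le> r}"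
  have finB: "finite ?B"
    by (rule finite_words)
  have finJ: "finite J" using J F finite_subset by auto
  have "F \<subseteq> (\<lambda>(s, w). w \<otimes>\<^bsub>F2\<^esub> s) ` (J \<times> ?B)"
  proof
    fix t assume t: "t \<in> F"
    have rt: "reduced_word t" using t F by auto
    have "\<exists>s\<in>J. length (t \<otimes>\<^bsub>F2\<^esub> inv\<^bsub>F2\<^esub> s) \<le> r"
    proof (rule ccontr)
      assume "\<not> ?thesis"
      hence far: "r < length (t \<otimes>\<^bsub>F2\<^esub> inv\<^bsub>F2\<^esub> s)" if "s \<in> J" for s using that by force
      have sym: "length (s \<otimes>\<^bsub>F2\<^esub> inv\<^bsub>F2\<^esub> t) = length (t \<otimes>\<^bsub>F2\<^esub> inv\<^bsub>F2\<^esub> s)" if "s \<in> J" for s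
      proof -
        have rs: "reduced_word s" using that J F by auto
        have "inv\<^bsub>F2\<^esub> (t \<otimes>\<^bsub>F2\<^esub> inv\<^bsub>F2\<^esub> s) = s \<otimes>\<^bsub>F2\<^esub> inv\<^bsub>F2\<^esub> t"
          using rs rt by (simp add: free_group.inv_mult_group)
        moreover have "reduced_word (t \<otimes>\<^bsub>F2\<^esub> inv\<^bsub>F2\<^esub> s)"
          using rs rt by simp
        ultimately show ?thesis by (metis length_inv)
      qed
      \<comment> \<open>\<open>separated\<close> compares each pair in both orders, whence
        \<open>sym\<close>. Maximality then puts \<open>t\<close> into \<open>J\<close>, where it is
        at distance 0 from itself.\<close>
      have "insert t J \<in> ?S" using J t far sym by (auto simp: separated_def)
      hence "t \<in> J" using max by blast
      moreover have "length (t \<otimes>\<^bsub>F2\<^esub> inv\<^bsub>F2\<^esub> t) \<le> r"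
        using rt by (simp add: one_free_group)
      ultimately show False using far by force
    qed
    then obtain s where s: "s \<in> J" "length (t \<otimes>\<^bsub>F2\<^esub> inv\<^bsub>F2\<^esub> s) \<le> r" by blast
    have "reduced_word s" using s J F by auto
    hence "t = (t \<otimes>\<^bsub>F2\<^esub> inv\<^bsub>F2\<^esub> s) \<otimes>\<^bsub>F2\<^esub> s"
      using rt by (simp add: free_group.m_assoc)
    with s show "t \<in> (\<lambda>(s, w). w \<otimes>\<^bsub>F2\<^esub> s) ` (J \<times> ?B)" by force
  qed
  hence "card F \<le> card (J \<times> ?B)"
    by (rule surj_card_le[OF finite_cartesian_product[OF finJ finB]])
  with J show ?thesis by (auto simp: card_cartesian_product)
qed

section \<open>Cylinder neighbourhoods and independence density\<close>

text \<open>A basic open set of the product topology restricts only finitely many coordinates, all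
  of which lie in some ball around the identity.\<close>

lemma X_plus_cylinder:
  assumes "openin X_plus V" "x \<in> V"
  shows "\<exists>n. \<forall>z\<in>topspace X_plus. (\<forall>h. reduced_word h \<longrightarrow> length h \<le> n \<longrightarrow> z h = x h) \<longrightarrow> z \<in> V"
proof -
  obtain T where T: "openin full_shift T" "V = T \<inter> topspace X_plus"
    using assms X_plus_eq by (metis openin_subtopology)
  then obtain U where U: "finite {g \<in> carrier F2. U g \<noteq> UNIV}"
      "x \<in> PiE (carrier F2) U" "PiE (carrier F2) U \<subseteq> T"
    using assms unfolding full_shift_def openin_product_topology_alt by auto
  let ?W = "{g \<in> carrier F2. U g \<noteq> UNIV}"
  obtain n where n: "\<And>g. g \<in> ?W \<Longrightarrow> length g \<le> n"
    using U(1) by (metis (no_types, lifting) finite_imageI finite_nat_set_iff_bounded_le imageI)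
  have "z \<in> V"
    if z: "z \<in> topspace X_plus" "\<And>h. reduced_word h \<Longrightarrow> length h \<le> n \<Longrightarrow> z h = x h" for z
  proof -
    have "z g \<in> U g" if "g \<in> carrier F2" for g
    proof (cases "U g = UNIV")
      case False
      hence "z g = x g" using that z(2) n by auto
      thus ?thesis using U(2) that by auto
    qed simp
    hence "z \<in> PiE (carrier F2) U" using z(1) by (auto simp: topspace_X_plus PiE_iff)
    thus ?thesis using T U(3) z(1) by auto
  qed
  thus ?thesis by blast
qed

text \<open>Gluing the patterns of \<open>x (\<phi> s)\<close> for all \<open>s\<close> in
  \<open>I\<close> gives one \<open>z\<close> whose translate by each \<open>s\<close> agrees with
  \<open>x (\<phi> s)\<close> on the ball of radius \<open>n\<close> and hence lies in
  \<open>U (\<phi> s)\<close>.\<close>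

lemma separated_imp_independence_set:
  assumes J: "separated (2 * n + 4) J" "J \<subseteq> carrier F2"
    and x: "\<And>i. i \<in> {1..k} \<Longrightarrow> x i \<in> topspace X_plus"
    and U: "\<And>i z. i \<in> {1..k} \<Longrightarrow> z \<in> topspace X_plus \<Longrightarrow>
      (\<And>h. reduced_word h \<Longrightarrow> length h \<le> n \<Longrightarrow> z h = x i h) \<Longrightarrow> z \<in> U i"
  shows "independence_set F2 left_shift k U J"
  unfolding independence_set_def
proof (intro conjI allI impI J(2))
  fix I \<phi> assume I: "finite I \<and> I \<noteq> {} \<and> I \<subseteq> J \<and> \<phi> \<in> I \<rightarrow> {1..k}"
  have "separated (2 * n + 4) I" using I J by (auto simp: separated_def)
  moreover have "I \<subseteq> carrier F2" using I J by blast
  moreover have "x (\<phi> s) \<in> topspace X_plus" if "s \<in> I" for s using I x that by blast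
  ultimately obtain z where z: "z \<in> topspace X_plus"
      "\<And>s h. s \<in> I \<Longrightarrow> reduced_word h \<Longrightarrow> length h \<le> n + 1 \<Longrightarrow>
        z (inv\<^bsub>F2\<^esub> s \<otimes>\<^bsub>F2\<^esub> h) = x (\<phi> s) h"
    using glue_on_separated[of n I "\<lambda>s. x (\<phi> s)"] by blast
  have "z \<in> left_shift (inv\<^bsub>F2\<^esub> s) ` U (\<phi> s)" if s: "s \<in> I" for s
  proof
    have sF: "s \<in> carrier F2" using I J s by blast
    show "z = left_shift (inv\<^bsub>F2\<^esub> s) (left_shift s z)"
      using left_shift_mult[of "inv\<^bsub>F2\<^esub> s" s z] sF z(1)
      by (simp add: left_shift_one)
    show "left_shift s z \<in> U (\<phi> s)"
    proof (rule U)
      show "\<phi> s \<in> {1..k}" using I s by blast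
      show "left_shift s z \<in> topspace X_plus" using left_shift_in_X_plus[OF sF z(1)] .
      show "left_shift s z h = x (\<phi> s) h" if "reduced_word h" "length h \<le> n" for h
        using z(2)[OF s, of h] that z(1) by (simp add: left_shift_def)
    qed
  qed
  thus "(\<Inter>s\<in>I. left_shift (inv\<^bsub>F2\<^esub> s) ` U (\<phi> s)) \<noteq> {}" by blast
qed

theorem proposition7p12:
  shows "naive_UPE_all_orders F2 X_plus left_shift"
proof -
  have "independence_density F2 left_shift k U > 0"
    if x: "x \<in> {1..k} \<rightarrow>\<^sub>E topspace X_plus"
      and U: "\<forall>i\<in>{1..k}. U i \<subseteq> topspace X_plus \<and> (\<exists>V. openin X_plus V \<and> x i \<in> V \<and> V \<subseteq> U i)"
    for k x U
  proof -
    have "\<exists>n. \<forall>z\<in>topspace X_plus.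
        (\<forall>h. reduced_word h \<longrightarrow> length h \<le> n \<longrightarrow> z h = x i h) \<longrightarrow> z \<in> U i"
      if i: "i \<in> {1..k}" for i
    proof -
      obtain V where V: "openin X_plus V" "x i \<in> V" "V \<subseteq> U i" using U i by blast
      from X_plus_cylinder[OF V(1,2)] show ?thesis using V(3) by blast
    qed
    then obtain N where N: "\<And>i z. i \<in> {1..k} \<Longrightarrow> z \<in> topspace X_plus \<Longrightarrow>
        (\<And>h. reduced_word h \<Longrightarrow> length h \<le> N i \<Longrightarrow> z h = x i h) \<Longrightarrow> z \<in> U i"
      by metis
    \<comment> \<open>One radius for all coordinates; inserting 0 keeps the set nonempty if
      \<open>k = 0\<close>.\<close>
    define n where "n = Max (insert 0 (N ` {1..k}))"
    have Nn: "N i \<le> n" if "i \<in> {1..k}" for i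
      unfolding n_def using that by (intro Max_ge) auto
    have cyl: "z \<in> U i" if "i \<in> {1..k}" "z \<in> topspace X_plus"
        "\<And>h. reduced_word h \<Longrightarrow> length h \<le> n \<Longrightarrow> z h = x i h" for i z
      using that Nn[OF that(1)] by (intro N[OF that(1,2)]) auto
    let ?B = "{w :: f2. length w \<le> 2 * n + 4}"
    have "[] \<in> ?B" by simp
    hence B: "card ?B > 0" using finite_words by (metis card_gt_0_iff empty_iff)
    \<comment> \<open>The proportion depends only on \<open>n\<close>, not on \<open>F\<close>,
      which is what makes the density positive.\<close>
    have "independence_density_bound F2 left_shift k U (1 / real (card ?B))"
      unfolding independence_density_bound_def
    proof (intro conjI allI impI)
      fix F assume F: "finite F \<and> F \<subseteq> carrier F2"
      obtain J where J: "J \<subseteq> F" "separated (2 * n + 4) J" "card F \<le> card J * card ?B"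
        using large_separated_subset[of F "2 * n + 4"] F by blast
      have "independence_set F2 left_shift k U J"
        using J F x by (intro separated_imp_independence_set[OF J(2) _ _ cyl]) auto
      moreover have "real (card F) \<le> real (card J) * real (card ?B)"
        using J(3) by (metis of_nat_mono of_nat_mult)
      hence "1 / real (card ?B) * real (card F) \<le> real (card J)"
        using B by (simp add: divide_le_eq)
      ultimately show "\<exists>J\<subseteq>F. independence_set F2 left_shift k U J \<and>
          1 / real (card ?B) * real (card F) \<le> real (card J)"
        using J(1) by blast
    qed simp
    from independence_density_greatest(2)[OF group_free_group this]
    have "1 / real (card ?B) \<le> independence_density F2 left_shift k U" .
    moreover have "0 < 1 / real (card ?B)" using B by simp
    ultimately show ?thesis by linarith
  qed
  thus ?thesis
    unfolding naive_UPE_all_orders_def IE_def by blast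
qed

end
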